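(* Let $X$ be an $N_1\times N_2$ matrix with integer entries, with two-dimensional DFT coefficients $\tilde X_{kl}$. For every $0\le k<N_1$, every $0\le l<N_2$, and every frequency $(k',l')$ with $(k',l')\sim(k,l)$, one has $\tilde X_{kl}=0$ if and only if $\tilde X_{k'l'}=0$.
   Context: $N_1,N_2$ are positive integers. Matrix entries $X_{mn}$ are indexed by $0\le m<N_1$, $0\le n<N_2$. The two-dimensional DFT of $X$ is $\tilde X_{kl}=\sum_{m=0}^{N_1-1}\sum_{n=0}^{N_2-1}X_{mn}\,e^{-2\pi i\left(\frac{mk}{N_1}+\frac{nl}{N_2}\right)}$ for integers $k,l$; it is periodic with period $N_1$ in $k$ and $N_2$ in $l$. A frequency is a pair of integers (taken modulo $N_1$ and $N_2$ respectively). For a frequency $(k,l)$ put $D_1=N_1/\gcd(k,N_1)$, $D_2=N_2/\gcd(l,N_2)$, $D=\operatorname{lcm}(D_1,D_2)$ (with $\gcd(0,N)=N$). Two frequencies are equivalent, written $(k,l)\sim(k',l')$, if there exists a nonzero integer $\lambda$ relatively prime to $D$ such that $k'\equiv\lambda k\pmod{N_1}$ and $l'\equiv\lambda l\pmod{N_2}$. This is an equivalence relation on frequencies. *)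

theory Defs
  imports "HOL-Analysis.Analysis" "HOL-Number_Theory.Cong"
begin

text \<open>
  An \<open>N1 \<times> N2\<close> matrix is a function on index pairs; only its values at
  \<open>m < N1\<close>, \<open>n < N2\<close> are ever used. A frequency is represented by any pair of
  integers lying in its residue class modulo \<open>(N1, N2)\<close>.
\<close>

definition dft2 :: "nat \<Rightarrow> nat \<Rightarrow> (nat \<Rightarrow> nat \<Rightarrow> complex) \<Rightarrow> int \<Rightarrow> int \<Rightarrow> complex" where
  "dft2 N1 N2 X k l =
     (\<Sum>m<N1. \<Sum>n<N2. X m n *
        exp (- 2 * of_real pi * \<i> *
             (of_nat m * of_int k / of_nat N1 + of_nat n * of_int l / of_nat N2)))"

definition freq_modulus :: "nat \<Rightarrow> nat \<Rightarrow> int \<times> int \<Rightarrow> int" where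
  "freq_modulus N1 N2 = (\<lambda>(k, l). lcm (int N1 div gcd k (int N1)) (int N2 div gcd l (int N2)))"

text \<open>The coprimality condition refers to the modulus of the left argument.\<close>

definition freq_equiv :: "nat \<Rightarrow> nat \<Rightarrow> int \<times> int \<Rightarrow> int \<times> int \<Rightarrow> bool" where
  "freq_equiv N1 N2 = (\<lambda>(k, l) (k', l').
     \<exists>c::int. c \<noteq> 0 \<and> coprime c (freq_modulus N1 N2 (k, l)) \<and>
       [k' = c * k] (mod int N1) \<and> [l' = c * l] (mod int N2))"

end

theory Submission
  imports Defs "Jordan_Normal_Form.Char_Poly"
begin

text \<open>
  Both coefficients are values of one integer polynomial \<open>f\<close>. Let \<open>D\<close> be the modulus of
  \<open>(k', l')\<close> and \<open>z = exp (-2 \<pi> \<i> / D)\<close>. The numbers \<open>exp (-2 \<pi> \<i> k' / N1)\<close> and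
  \<open>exp (-2 \<pi> \<i> l' / N2)\<close> are powers \<open>z\<^sup>i\<close> and \<open>z\<^sup>j\<close>, so the coefficient at \<open>(k', l')\<close> is
  \<open>f(z)\<close> for the polynomial \<open>f\<close> with a term \<open>X m n\<close> of degree \<open>i m + j n\<close> for each entry.
  Multiplying the frequency by \<open>c\<close> replaces \<open>z\<close> by \<open>z\<^sup>c\<close>. It therefore suffices that \<open>f(z) = 0\<close>
  implies \<open>f(z\<^sup>c) = 0\<close> when \<open>z\<^sup>D = 1\<close> and \<open>c\<close> is coprime to \<open>D\<close>; the converse is the same
  statement for \<open>z\<^sup>c\<close> and an inverse of \<open>c\<close> modulo \<open>D\<close>.

  That implication is equivalent to the irreducibility of cyclotomic polynomials. Landau's
  method proves it without minimal polynomials. For a prime \<open>p\<close>, the Frobenius congruence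
  \<open>f(x)\<^sup>p \<equiv> f(x\<^sup>p)\<close> modulo \<open>p\<close> shows that \<open>f(z) = 0\<close> forces \<open>f(z\<^sup>p)\<close> into
  \<open>p \<int>[z]\<close>. The numbers \<open>f(w)\<close> with \<open>w\<^sup>D = 1\<close> form a finite set of algebraic
  integers, and a nonzero algebraic integer cannot be divisible by an arbitrarily large prime:
  the prime would divide the nonzero constant coefficient of an integer polynomial that
  vanishes there. Hence \<open>f(z\<^sup>p) = 0\<close> for all primes beyond a bound
  (\<open>large_prime_power_preserves_root\<close>). Finally \<open>z\<^sup>c\<close> depends only on \<open>c\<close> modulo \<open>D\<close>,
  and the class of \<open>c\<close> contains a number all of whose prime factors exceed that bound
  (\<open>ex_cong_large_prime_factors\<close>); the prime steps then compose. This elementary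
  construction takes the place of Dirichlet's theorem on primes in arithmetic progressions.
\<close>

section \<open>Integer polynomials at roots of unity\<close>

abbreviation ipoly :: "int poly \<Rightarrow> complex \<Rightarrow> complex" where
  "ipoly f z \<equiv> poly (of_int_poly f) z"

lemma ipoly_simps:
  "ipoly (f + g) z = ipoly f z + ipoly g z"
  "ipoly (f - g) z = ipoly f z - ipoly g z"
  "ipoly (- f) z = - ipoly f z"
  "ipoly (f * g) z = ipoly f z * ipoly g z"
  "ipoly (f ^ n) z = ipoly f z ^ n"
  "ipoly (of_nat n) z = of_nat n"
  "ipoly (pCons a f) z = of_int a + z * ipoly f z"
  "ipoly (monom a n) z = of_int a * z ^ n"
  by (simp_all add: of_int_poly_hom.hom_add of_int_poly_hom.hom_minus of_int_poly_hom.hom_uminus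
      of_int_poly_hom.hom_mult of_int_poly_hom.hom_power poly_monom
      of_nat_poly of_int_hom.map_poly_pCons_hom)

lemma ipoly_sum: "ipoly (\<Sum>i\<in>A. f i) z = (\<Sum>i\<in>A. ipoly (f i) z)"
  by (simp add: of_int_poly_hom.hom_sum poly_sum)

lemma ipoly_pcompose: "ipoly (pcompose f g) z = ipoly f (ipoly g z)"
  by (induction f) (simp_all add: pcompose_pCons ipoly_simps)

text \<open>
  Such an \<open>r\<close> is a root of the characteristic polynomial of the integer matrix \<open>A\<close>, which is
  monic with integer coefficients.
\<close>
lemma algebraic_int_eigenvalue:
  fixes r :: complex and A :: "nat \<Rightarrow> nat \<Rightarrow> int"
  assumes "\<And>i. i < n \<Longrightarrow> (\<Sum>j<n. of_int (A i j) * v j) = r * v i"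
    and "i0 < n" "v i0 \<noteq> 0"
  shows "algebraic_int r"
proof -
  define M where "M = mat n n (\<lambda>(i, j). A i j)"
  define C :: "complex mat" where "C = map_mat of_int M"
  have M: "M \<in> carrier_mat n n" and C: "C \<in> carrier_mat n n"
    by (auto simp: M_def C_def)
  have "C *\<^sub>v vec n v = r \<cdot>\<^sub>v vec n v"
    using assms(1) by (intro eq_vecI) (auto simp: C_def M_def scalar_prod_def lessThan_atLeast0)
  moreover have "vec n v \<noteq> 0\<^sub>v n"
    using assms(2,3) by (metis index_vec index_zero_vec(1))
  ultimately have "eigenvalue C r"
    unfolding eigenvalue_def eigenvector_def using C by (intro exI[of _ "vec n v"]) auto
  hence "poly (char_poly C) r = 0"
    using eigenvalue_root_char_poly[OF C] by simp
  hence "poly (of_int_poly (char_poly M)) r = 0"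
    unfolding C_def of_int_hom.char_poly_hom[OF M] .
  moreover have "lead_coeff (char_poly M) = 1"
    using degree_monic_char_poly[OF M] by auto
  ultimately show ?thesis
    unfolding algebraic_int_altdef_ipoly by blast
qed

text \<open>
  Multiplication by \<open>f(z)\<close> maps each of \<open>1, z, \<dots>, z\<^bsup>D-1\<^esup>\<close> to an integer combination of
  these numbers, since exponents may be reduced modulo \<open>D\<close>; so \<open>f(z)\<close> is an eigenvalue of an
  integer circulant matrix, with these powers as eigenvector.
\<close>
lemma algebraic_int_ipoly_root_of_unity:
  assumes "D > 0" "z ^ D = 1"
  shows "algebraic_int (ipoly f z)"
proof (rule algebraic_int_eigenvalue[where n = D and v = "\<lambda>i. z ^ i" and ?i0.0 = 0
      and A = "\<lambda>i j. \<Sum>k\<le>degree f. if (i + k) mod D = j then coeff f k else 0"])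
  fix i assume "i < D"
  have red: "z ^ (m mod D) = z ^ m" for m
    using assms(2) by (metis mod_mult_div_eq mult.right_neutral power_add power_mult power_one)
  have "(\<Sum>j<D. of_int (\<Sum>k\<le>degree f. if (i + k) mod D = j then coeff f k else 0) * z ^ j)
      = (\<Sum>j<D. \<Sum>k\<le>degree f. if (i + k) mod D = j then of_int (coeff f k) * z ^ j else 0)"
    by (auto simp: sum_distrib_right intro!: sum.cong)
  also have "\<dots> = (\<Sum>k\<le>degree f. \<Sum>j<D. if (i + k) mod D = j then of_int (coeff f k) * z ^ j else 0)"
    by (rule sum.swap)
  also have "\<dots> = (\<Sum>k\<le>degree f. of_int (coeff f k) * z ^ ((i + k) mod D))"
    using assms(1) by (intro sum.cong) (auto simp: sum.delta')
  also have "\<dots> = (\<Sum>k\<le>degree f. of_int (coeff f k) * z ^ k) * z ^ i"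
    by (simp add: red power_add sum_distrib_left mult_ac)
  also have "(\<Sum>k\<le>degree f. of_int (coeff f k) * z ^ k) = ipoly f z"
    by (simp add: poly_altdef)
  finally show "(\<Sum>j<D. of_int (\<Sum>k\<le>degree f. if (i + k) mod D = j then coeff f k else 0) * z ^ j)
      = ipoly f z * z ^ i" .
qed (use assms in auto)

section \<open>The Frobenius congruence for integer polynomials\<close>

text \<open>
  The congruence form of the freshman's dream, for use in rings of characteristic zero: the
  inner binomial coefficients of a prime exponent are divisible by it.
\<close>
lemma prime_dvd_add_power:
  fixes x y :: "'a :: comm_ring_1"
  assumes "prime p"
  shows "of_nat p dvd (x + y) ^ p - (x ^ p + y ^ p)"
proof -
  have p: "p > 1" using assms prime_gt_1_nat by blast
  let ?t = "\<lambda>k. of_nat (p choose k) * x ^ k * y ^ (p - k)"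
  have "{..p} = insert 0 (insert p {1..<p})" using p by auto
  hence "(x + y) ^ p - (x ^ p + y ^ p) = (\<Sum>k=1..<p. ?t k)"
    using p by (simp add: binomial_ring)
  also have "of_nat p dvd \<dots>"
  proof (rule dvd_sum)
    fix k assume "k \<in> {1..<p}"
    hence "p dvd (p choose k)" using assms by (intro dvd_choose_prime) auto
    thus "of_nat p dvd ?t k"
      by (metis dvd_mult2 of_nat_dvd_iff of_nat_mult dvd_def mult.assoc)
  qed
  finally show ?thesis .
qed

text \<open>
  Fermat's little theorem, extended from \<open>0\<close> to all integers in steps of one by the preceding
  congruence.
\<close>
lemma prime_dvd_int_power_diff:
  assumes "prime p"
  shows "int p dvd a ^ p - a"
proof (induction a rule: int_induct[where k = 0])
  case base
  show ?case using assms prime_gt_0_nat by (simp add: power_0_left)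
next
  case (step1 i)
  have "(i + 1) ^ p - (i + 1) = ((i + 1) ^ p - (i ^ p + 1 ^ p)) + (i ^ p - i)" by simp
  thus ?case using prime_dvd_add_power[OF assms, of i 1] step1 by (metis dvd_add of_nat_id)
next
  case (step2 i)
  have "(i - 1) ^ p - (i - 1) = (i ^ p - i) - ((i - 1 + 1) ^ p - ((i - 1) ^ p + 1 ^ p))" by simp
  thus ?case using prime_dvd_add_power[OF assms, of "i - 1" 1] step2 by (metis dvd_diff of_nat_id)
qed

text \<open>
  Taking \<open>p\<close>-th powers is additive modulo \<open>p\<close> and fixes the constants modulo \<open>p\<close>, hence acts
  on polynomials as the substitution of \<open>x\<^sup>p\<close> for \<open>x\<close>.
\<close>
lemma prime_dvd_frobenius_poly:
  fixes f :: "int poly"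
  assumes "prime p"
  shows "of_nat p dvd f ^ p - pcompose f (monom 1 p)"
proof (induction f)
  case 0
  show ?case using assms prime_gt_0_nat by (simp add: power_0_left)
next
  case (pCons a f)
  let ?X = "monom 1 1 :: int poly"
  have split: "pCons a f = [:a:] + ?X * f"
    by (simp add: monom_altdef)
  have A: "of_nat p dvd [:a:] ^ p - [:a:]"
  proof -
    from prime_dvd_int_power_diff[OF assms, of a] obtain b where "a ^ p - a = int p * b" by (elim dvdE)
    hence "[:a:] ^ p - [:a:] = of_nat p * [:b:]"
      by (simp add: poly_const_pow of_nat_poly)
    thus ?thesis by (rule dvdI)
  qed
  have "?X ^ p = monom 1 p" by (simp add: monom_power)
  hence "pCons a f ^ p - pcompose (pCons a f) (monom 1 p) =
     (([:a:] + ?X * f) ^ p - ([:a:] ^ p + (?X * f) ^ p)) + ([:a:] ^ p - [:a:])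
       + monom 1 p * (f ^ p - pcompose f (monom 1 p))"
    unfolding pcompose_pCons by (simp only: split power_mult_distrib) (simp add: algebra_simps)
  also have "of_nat p dvd \<dots>"
    by (intro dvd_add prime_dvd_add_power assms A dvd_mult pCons.IH)
  finally show ?case .
qed

section \<open>Vanishing at coprime powers of a root of unity\<close>

text \<open>
  Powers of \<open>x\<close> can be cancelled from an integer equation for \<open>v\<close> because \<open>v\<close> is nonzero.
\<close>
lemma ex_int_poly_root_nonzero_const:
  assumes "algebraic_int (v :: complex)" "v \<noteq> 0"
  obtains q where "ipoly q v = 0" "coeff q 0 \<noteq> 0"
proof -
  have ex: "\<exists>q. ipoly q v = 0 \<and> coeff q 0 \<noteq> 0" if "q \<noteq> 0" "ipoly q v = 0" for q
    using that
  proof (induction q)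
    case (pCons a q)
    show ?case
    proof (cases "a = 0")
      case True
      with pCons assms(2) show ?thesis by (auto simp: ipoly_simps)
    next
      case False
      with pCons.prems show ?thesis by (intro exI[of _ "pCons a q"]) auto
    qed
  qed simp
  from assms(1) obtain q where "ipoly q v = 0" "lead_coeff q = 1"
    unfolding algebraic_int_altdef_ipoly by blast
  thus ?thesis using ex[of q] that by fastforce
qed

text \<open>
  The bound \<open>B\<close> has to serve all \<open>D\<close>-th roots of unity \<open>z\<close> at once, because several primes are
  applied in succession and the base changes at every step. It can, since \<open>f\<close> takes only
  finitely many values at these roots.
\<close>
lemma large_prime_power_preserves_root:
  fixes f :: "int poly"
  assumes "D > 0"
  obtains B :: nat where
    "\<And>p z. prime p \<Longrightarrow> p > B \<Longrightarrow> z ^ D = 1 \<Longrightarrow> ipoly f z = 0 \<Longrightarrow> ipoly f (z ^ p) = 0"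
proof -
  define V where "V = ipoly f ` {z. z ^ D = 1} - {0}"
  have fin: "finite V"
    unfolding V_def using finite_roots_unity[of D, where ?'a = complex] assms by auto
  have "\<exists>q. ipoly q v = 0 \<and> coeff q 0 \<noteq> 0" if "v \<in> V" for v
  proof -
    from that have "algebraic_int v" "v \<noteq> 0"
      using algebraic_int_ipoly_root_of_unity[OF assms] by (auto simp: V_def)
    thus ?thesis by (metis ex_int_poly_root_nonzero_const)
  qed
  then obtain q where q: "\<And>v. v \<in> V \<Longrightarrow> ipoly (q v) v = 0 \<and> coeff (q v) 0 \<noteq> 0" by metis
  define B where "B = (\<Sum>v\<in>V. nat \<bar>coeff (q v) 0\<bar>)"
  show ?thesis
  proof (rule that[of B], rule ccontr)
    fix p z assume p: "prime p" "p > B" and z: "z ^ D = 1" and f: "ipoly f z = 0"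
      and nz: "ipoly f (z ^ p) \<noteq> 0"
    define v where "v = ipoly f (z ^ p)"
    have "(z ^ p) ^ D = 1" using z by (metis power_mult mult.commute power_one)
    hence v: "v \<in> V" using nz by (auto simp: V_def v_def)
    obtain a q' where qv: "q v = pCons a q'" by (cases "q v")
    have a: "a \<noteq> 0" "of_int a + v * ipoly q' v = 0" using q[OF v] qv by (auto simp: ipoly_simps)
    from prime_dvd_frobenius_poly[OF p(1), of f] obtain h where
      "f ^ p - pcompose f (monom 1 p) = of_nat p * h" by (elim dvdE)
    hence "ipoly (f ^ p - pcompose f (monom 1 p)) z = ipoly (of_nat p * h) z" by simp
    hence "- v = of_nat p * ipoly h z"
      using f prime_gt_0_nat[OF p(1)]
      by (simp add: ipoly_simps ipoly_pcompose v_def power_0_left poly_monom)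
    hence vh: "v = - (of_nat p * ipoly h z)" by (metis add.inverse_inverse)
    \<comment> \<open>Since \<open>v\<close> is a multiple of \<open>p\<close> in \<open>\<int>[z]\<close>, its equation makes the constant
      coefficient \<open>a\<close> such a multiple too; the quotient is rational, hence an integer.\<close>
    define g where "g = h * pcompose q' (pcompose f (monom 1 p))"
    have g: "of_int a = of_nat p * ipoly g z"
    proof -
      have "ipoly g z = ipoly h z * ipoly q' v"
        by (simp add: g_def ipoly_simps ipoly_pcompose poly_monom v_def)
      moreover have "of_int a = - v * ipoly q' v" using a(2) by (simp add: add_eq_0_iff2)
      moreover have "- v = of_nat p * ipoly h z" using vh by simp
      ultimately show ?thesis by (metis mult.assoc)
    qed
    have "ipoly g z = of_int a / of_nat p" using g prime_gt_0_nat[OF p(1)] by simp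
    hence "ipoly g z \<in> \<rat>" by simp
    hence "ipoly g z \<in> \<int>"
      using rational_algebraic_int_is_int algebraic_int_ipoly_root_of_unity[OF assms z] by blast
    then obtain b where "ipoly g z = of_int b" by (elim Ints_cases)
    with g have "(of_int a :: complex) = of_int (int p * b)" by simp
    hence "int p dvd a" unfolding of_int_eq_iff by simp
    hence "int p \<le> \<bar>a\<bar>" using dvd_imp_le_int[OF a(1), of "int p"] by simp
    moreover have "nat \<bar>a\<bar> \<le> B"
      unfolding B_def using member_le_sum[OF v, of "\<lambda>v. nat \<bar>coeff (q v) 0\<bar>"] fin qv by simp
    ultimately show False using p(2) by linarith
  qed
qed

text \<open>
  Add to \<open>c\<close> the product of \<open>D\<close> and the small primes that do not divide \<open>c\<close>. Every small
  prime then divides exactly one of the two summands, as those dividing \<open>c\<close> do not divide \<open>D\<close>.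
\<close>
lemma ex_cong_large_prime_factors:
  fixes c D B :: nat
  assumes "coprime c D" "D > 0"
  obtains n where "n > 0" "[n = c] (mod D)" "\<And>p. prime p \<Longrightarrow> p dvd n \<Longrightarrow> p > B"
proof -
  define S where "S = {p. prime p \<and> p \<le> B \<and> \<not> p dvd c}"
  define n where "n = c + D * \<Prod>S"
  have fin: "finite S" by (rule finite_subset[of _ "{..B}"]) (auto simp: S_def)
  have "p > B" if p: "prime p" "p dvd n" for p
  proof (rule ccontr)
    assume "\<not> p > B"
    show False
    proof (cases "p dvd c")
      case True
      hence "p dvd D * \<Prod>S" using p(2) unfolding n_def by (simp add: dvd_add_right_iff)
      moreover have "\<not> p dvd D" using True assms(1) p(1)
        by (metis coprime_common_divisor_nat not_prime_1 nat_dvd_1_iff_1 coprime_def)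
      ultimately have "p dvd \<Prod>S" using p(1) prime_dvd_mult_iff by blast
      then obtain s where "s \<in> S" "p dvd s" using p(1) fin by (auto simp: prime_dvd_prod_iff)
      hence "p \<in> S" using p(1) by (auto simp: S_def dest: primes_dvd_imp_eq)
      thus False using True by (simp add: S_def)
    next
      case False
      hence "p dvd \<Prod>S" using p(1) \<open>\<not> p > B\<close> fin
        by (intro dvd_prodI[of S p "\<lambda>x. x", simplified]) (auto simp: S_def)
      hence "p dvd c" using p(2) unfolding n_def by (metis dvd_add_left_iff dvd_mult)
      with False show False by simp
    qed
  qed
  moreover have "n > 0"
    using assms(2) fin by (auto simp: n_def S_def prime_gt_0_nat)
  moreover have "[n = c] (mod D)" by (simp add: n_def cong_def)
  ultimately show ?thesis using that by blast
qed

text \<open>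
  This says that the conjugates of a root of unity include all its powers with exponent
  coprime to \<open>D\<close>,
  which is the irreducibility of the cyclotomic polynomials in the form needed here.
\<close>
lemma ipoly_root_of_unity_coprime_power:
  fixes f :: "int poly" and c D :: nat
  assumes "D > 0" "z ^ D = 1" "coprime c D" "ipoly f z = 0"
  shows "ipoly f (z ^ c) = 0"
proof -
  obtain B :: nat where B:
    "\<And>p z. prime p \<Longrightarrow> p > B \<Longrightarrow> z ^ D = 1 \<Longrightarrow> ipoly f z = 0 \<Longrightarrow> ipoly f (z ^ p) = 0"
    using large_prime_power_preserves_root[OF assms(1)] by metis
  obtain n where n: "n > 0" "[n = c] (mod D)" "\<And>p. prime p \<Longrightarrow> p dvd n \<Longrightarrow> p > B"
    using ex_cong_large_prime_factors[OF assms(3,1)] by metis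
  have "ipoly f (z ^ n) = 0"
    using n(1,3) assms(2,4)
  proof (induction n arbitrary: z rule: prime_divisors_induct)
    case (factor p m)
    have "(z ^ p) ^ D = 1" using factor.prems by (metis power_mult mult.commute power_one)
    moreover have "ipoly f (z ^ p) = 0"
      using factor by (intro B) auto
    ultimately have "ipoly f ((z ^ p) ^ m) = 0"
      using factor.prems by (intro factor.IH) auto
    thus ?case by (simp add: power_mult)
  qed auto
  moreover have "z ^ n = z ^ c"
    using n(2) assms(2) unfolding cong_def
    by (metis mod_mult_div_eq mult.right_neutral power_add power_mult power_one)
  ultimately show ?thesis by simp
qed

section \<open>Fourier coefficients as values of an integer polynomial\<close>

lemma exp_dft_kernel_eq_power:
  "exp (- 2 * of_real pi * \<i> * (of_nat m * of_int k / of_nat N1 + of_nat n * of_int l / of_nat N2))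
    = cis (- 2 * pi * (k / N1)) ^ m * cis (- 2 * pi * (l / N2)) ^ n"
  unfolding Complex.DeMoivre cis_mult
  by (simp add: cis_conv_exp algebra_simps)

text \<open>
  The divisibility says that the fraction \<open>k/N\<close> can be written with denominator \<open>D\<close>; reducing
  its numerator modulo \<open>D\<close> gives a natural exponent.
\<close>
lemma cis_fraction_eq_power:
  assumes "D > 0" and "int N dvd int D * k" and "N > 0"
  obtains i :: nat where "cis (- 2 * pi * (k / N)) = cis (- 2 * pi / D) ^ i"
proof -
  from assms(2) obtain a where a: "int D * k = int N * a" by (elim dvdE)
  define i where "i = nat (a mod int D)"
  have i: "a = int D * (a div int D) + int i" using assms(1) by (simp add: i_def)
  have "real D * k = N * real_of_int a"
    using arg_cong[OF a, of real_of_int] by simp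
  hence "k / N = a / D" using assms by (simp add: field_simps)
  also have "a / D = real_of_int (a div int D) + i / D"
    using arg_cong[OF i, of real_of_int] assms(1) by (simp add: field_simps)
  finally have "cis (- 2 * pi * (k / N))
      = cis (2 * pi * real_of_int (- (a div int D))) * cis (real i * (- 2 * pi / D))"
    by (simp add: cis_mult algebra_simps)
  also have "cis (2 * pi * real_of_int (- (a div int D))) = 1"
    by (rule cis_multiple_2pi) simp
  finally show ?thesis using that[of i] by (simp add: Complex.DeMoivre)
qed

lemma cis_fraction_mult:
  assumes "[k = int c * k'] (mod int N)" and "N > 0"
  shows "cis (- 2 * pi * (k / N)) = cis (- 2 * pi * (k' / N)) ^ c"
proof -
  from assms(1) obtain t where t: "k = int c * k' + int N * t"
    by (metis cong_iff_lin cong_sym)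
  hence "k / N = c * (k' / N) + real_of_int t"
    using assms(2) by (simp add: field_simps)
  hence "cis (- 2 * pi * (k / N))
      = cis (2 * pi * real_of_int (- t)) * cis (real c * (- 2 * pi * (k' / N)))"
    by (simp add: cis_mult algebra_simps)
  also have "cis (2 * pi * real_of_int (- t)) = 1"
    by (rule cis_multiple_2pi) simp
  finally show ?thesis by (simp add: Complex.DeMoivre)
qed

lemma dvd_div_gcd_mult:
  fixes N k D :: int
  assumes "N div gcd k N dvd D"
  shows "N dvd D * k"
proof -
  have "N = (N div gcd k N) * gcd k N" by simp
  also have "\<dots> dvd D * k" using assms by (intro mult_dvd_mono) auto
  finally show ?thesis .
qed

theorem theorem3p3:
  fixes N1 N2 :: nat and X :: "nat \<Rightarrow> nat \<Rightarrow> int" and k l k' l' :: int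
  assumes "N1 > 0" and "N2 > 0"
    and "0 \<le> k" and "k < int N1" and "0 \<le> l" and "l < int N2"
    and "freq_equiv N1 N2 (k', l') (k, l)"
  shows "dft2 N1 N2 (\<lambda>m n. of_int (X m n)) k l = 0 \<longleftrightarrow>
         dft2 N1 N2 (\<lambda>m n. of_int (X m n)) k' l' = 0"
proof -
  define D where "D = nat (freq_modulus N1 N2 (k', l'))"
  have "int N div gcd x (int N) \<noteq> 0" if "N > 0" for x N
    using that by (metis div_eq_0_iff dvd_div_eq_0_iff gcd_dvd2 of_nat_0_eq_iff less_numeral_extra(3))
  hence "freq_modulus N1 N2 (k', l') > 0"
    using assms(1,2) unfolding freq_modulus_def by (simp add: lcm_pos_int)
  hence D: "D > 0" "int D = freq_modulus N1 N2 (k', l')" by (auto simp: D_def)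
  have dvd: "int N1 dvd int D * k'" "int N2 dvd int D * l'"
    by (rule dvd_div_gcd_mult; simp add: D(2) freq_modulus_def)+

  from assms(7) obtain c0 where c0: "coprime c0 (int D)"
    "[k = c0 * k'] (mod int N1)" "[l = c0 * l'] (mod int N2)"
    unfolding freq_equiv_def D(2) by auto
  \<comment> \<open>The multiplier may be negative. Reducing it modulo \<open>D\<close> makes it a natural number; this
    preserves its effect on \<open>(k', l')\<close> because \<open>D\<close> annihilates that frequency.\<close>
  define c where "c = nat (c0 mod int D)"
  have c: "int c = c0 mod int D" using D(1) by (simp add: c_def)
  have "coprime (int c) (int D)" using c0(1) D(1) unfolding c by simp
  hence cop: "coprime c D" by simp
  have red: "[c0 * x = int c * x] (mod N)" if "N dvd int D * x" for N x
  proof -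
    have "c0 * x - int c * x = (c0 - c0 mod int D) * x"
      unfolding c by (simp add: left_diff_distrib)
    also have "\<dots> = (c0 div int D) * (int D * x)"
      by (simp add: minus_mod_eq_mult_div)
    finally have "c0 * x - int c * x = (c0 div int D) * (int D * x)" .
    thus ?thesis using that by (simp add: cong_iff_dvd_diff)
  qed
  have kc: "[k = int c * k'] (mod int N1)" and lc: "[l = int c * l'] (mod int N2)"
    using c0(2,3) red dvd cong_trans by blast+

  define z where "z = cis (- 2 * pi / D)"
  have z: "z ^ D = 1" using D(1) unfolding z_def Complex.DeMoivre
    by (simp add: complex_eq_iff)
  obtain i where i: "cis (- 2 * pi * (k' / N1)) = z ^ i"
    unfolding z_def by (rule cis_fraction_eq_power[OF D(1) dvd(1) assms(1)])
  obtain j where j: "cis (- 2 * pi * (l' / N2)) = z ^ j"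
    unfolding z_def by (rule cis_fraction_eq_power[OF D(1) dvd(2) assms(2)])
  define f where "f = (\<Sum>m<N1. \<Sum>n<N2. monom (X m n) (i * m + j * n))"
  have f: "ipoly f y = (\<Sum>m<N1. \<Sum>n<N2. of_int (X m n) * ((y ^ i) ^ m * (y ^ j) ^ n))" for y
    by (simp add: f_def ipoly_sum ipoly_simps poly_monom power_add power_mult)
  have 1: "dft2 N1 N2 (\<lambda>m n. of_int (X m n)) k' l' = ipoly f z"
    unfolding dft2_def exp_dft_kernel_eq_power f i j ..
  have "dft2 N1 N2 (\<lambda>m n. of_int (X m n)) k l = ipoly f (z ^ c)"
    unfolding dft2_def exp_dft_kernel_eq_power f
      cis_fraction_mult[OF kc assms(1)] cis_fraction_mult[OF lc assms(2)] i j
    by (simp add: mult.commute flip: power_mult)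
  moreover have "ipoly f (z ^ c) = 0 \<longleftrightarrow> ipoly f z = 0"
  proof
    assume 0: "ipoly f (z ^ c) = 0"
    obtain d where d: "[c * d = 1] (mod D)"
      using cong_solve_coprime_nat[OF cop] by auto
    have "coprime d D" using d by (metis coprime_iff_invertible_nat mult.commute One_nat_def)
    moreover have "(z ^ c) ^ D = 1" using z by (metis power_mult mult.commute power_one)
    ultimately have "ipoly f ((z ^ c) ^ d) = 0"
      using ipoly_root_of_unity_coprime_power[OF D(1)] 0 by blast
    moreover have "(z ^ c) ^ d = z"
      using d z unfolding cong_def
      by (metis mod_mult_div_eq mult.right_neutral power_add power_mult power_one power_one_right)
    ultimately show "ipoly f z = 0" by simp
  qed (rule ipoly_root_of_unity_coprime_power[OF D(1) z cop])
  ultimately show ?thesis using 1 by simp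
qed

end
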